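(* Assume $\operatorname{Ker}\Phi\cap\operatorname{Ker}D^*=\{0\}$, let $\lambda>0$, let $y\notin\mathcal{H}_{\cdot,\lambda}$, let $A\in\mathbb{R}^{M\times Q}$, and let $J$ be the $D$-cosupport of a solution of $(\mathcal{P}_\lambda(y))$ such that $(H_J)$ holds. Then $$\widehat{df}^A_\lambda(y)=\mathbb{E}_Z\left(\langle\nu(Z),\Phi^*A^*AZ\rangle\right),$$ where $Z\sim\mathcal{N}(0,\operatorname{Id}_Q)$ and where, for any $z\in\mathbb{R}^Q$, $\nu=\nu(z)\in\mathbb{R}^N$ solves (together with some $\tilde\nu\in\mathbb{R}^{|J|}$) the linear system $$\begin{pmatrix} \Phi^*\Phi & D_J \\ D_J^* & 0 \end{pmatrix} \begin{pmatrix} \nu \\ \tilde\nu \end{pmatrix} = \begin{pmatrix} \Phi^*z \\ 0 \end{pmatrix}.$$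
   Context: $\Phi\in\mathbb{R}^{Q\times N}$; $D=(d_i)_{i=1}^P$ is a dictionary of atoms $d_i\in\mathbb{R}^N$, identified with the $N\times P$ matrix with columns $d_i$. $M^*$ is the adjoint (transpose), $\operatorname{Id}$ the identity, $\mathbb{R}_+=[0,\infty)$. For $y\in\mathbb{R}^Q$, $\lambda>0$, $(\mathcal{P}_\lambda(y))$ is the problem of minimizing over $x\in\mathbb{R}^N$ the function $\frac12\|y-\Phi x\|_2^2+\lambda\|D^*x\|_1$; a solution is a global minimizer. All solutions have the same image $\mu^\star_\lambda(y)$ under $\Phi$. For $J\subset\{1,\dots,P\}$, $J^c$ is its complement, $D_J$ the submatrix of $D$ with columns indexed by $J$ (with $\operatorname{Im}D_\emptyset=\{0\}$). The $D$-cosupport of $x$ is $\{i:(D^*x)_i=0\}$. $\mathcal{G}_J=\operatorname{Ker}D_J^*$. Condition $(H_J)$: $\operatorname{Ker}\Phi\cap\mathcal{G}_J=\{0\}$. When $(H_J)$ holds, $A^{[J]}=U_J(U_J^*\Phi^*\Phi U_J)^{-1}U_J^*$ with $U_J$ a matrix whose columns form a basis of $\mathcal{G}_J$ (and $A^{[J]}=0$ if $\mathcal{G}_J=\{0\}$), $\tilde\Pi^{[J]}=\Phi^*(\Phi A^{[J]}\Phi^*-\operatorname{Id})$, $\tilde\Omega^{[J]}=(\Phi^*\Phi A^{[J]}-\operatorname{Id})D_{J^c}$. $\operatorname{P}_{\mathcal{G}}$ is the orthogonal projector on $\mathcal{G}$. Let $$\mathcal{H}=\bigcup_{J\subset\{1,\dots,P\},\,(H_J)\text{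 holds}}\ \bigcup_{K\subset J,\ \operatorname{Im}\tilde\Pi^{[J]}\not\subseteq\operatorname{Im}D_{J\setminus K}}\ \bigcup_{s_{J^c}\in\{-1,1\}^{|J^c|}}\ \bigcup_{\sigma_K\in\{-1,1\}^{|K|}}\mathcal{H}_{J,K,s_{J^c},\sigma_K},$$ $$\mathcal{H}_{J,K,s_{J^c},\sigma_K}=\{(y,\lambda)\in\mathbb{R}^Q\times\mathbb{R}_+:\ \operatorname{P}_{\mathcal{G}_{J\setminus K}}\tilde\Pi^{[J]}y=\lambda\operatorname{P}_{\mathcal{G}_{J\setminus K}}(\tilde\Omega^{[J]}s_{J^c}-D_K\sigma_K)\},$$ and $\mathcal{H}_{\cdot,\lambda}=\{y\in\mathbb{R}^Q:(y,\lambda)\in\mathcal{H}\}$. For $y\notin\mathcal{H}_{\cdot,\lambda}$, $\mu^\star_\lambda$ is differentiable at $y$ with Jacobian $\Phi A^{[J]}\Phi^*$ (with $J$ the $D$-cosupport of any solution such that $(H_J)$ holds), and $$\widehat{df}^A_\lambda(y)=\operatorname{tr}\left(A\frac{\partial\mu^\star_\lambda(y)}{\partial y}A^*\right)=\operatorname{tr}(A\Phi A^{[J]}\Phi^*A^* ).$$ *)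

theory Defs
  imports "HOL-Probability.Probability"
begin

definition ker_mat :: "real^'b^'a \<Rightarrow> (real^'b) set" where
  "ker_mat M = {x. M *v x = 0}"

definition im_mat :: "real^'b^'a \<Rightarrow> (real^'a) set" where
  "im_mat M = range (\<lambda>x. M *v x)"

definition norm1 :: "real^'a \<Rightarrow> real" where
  "norm1 v = (\<Sum>i\<in>UNIV. \<bar>v $ i\<bar>)"

definition orth_proj :: "(real^'a) set \<Rightarrow> real^'a \<Rightarrow> real^'a" where
  "orth_proj G x = (THE p. p \<in> G \<and> x - p \<in> G\<^sup>\<bottom>)"


text \<open>
  Vectors indexed by a set \<open>J\<close> of atoms are encoded as vectors over the full index type that
  vanish outside \<open>J\<close>. Accordingly the submatrix \<open>D_J\<close> is encoded by zeroing the columns of \<open>D\<close>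
  outside \<open>J\<close>; its image, the kernel of its transpose, and its products with vectors indexed by
  \<open>J\<close> are those of the actual submatrix.
\<close>

definition vecs_on :: "'p set \<Rightarrow> (real^'p) set" where
  "vecs_on J = {v. \<forall>i. i \<notin> J \<longrightarrow> v $ i = 0}"

definition signs_on :: "'p set \<Rightarrow> (real^'p) set" where
  "signs_on J = {s \<in> vecs_on J. \<forall>i\<in>J. s $ i \<in> {-1, 1}}"

definition sub_cols :: "real^'p^'n \<Rightarrow> 'p set \<Rightarrow> real^'p^'n" where
  "sub_cols D J = (\<chi> i j. if j \<in> J then D $ i $ j else 0)"

definition cosupport :: "real^'p^'n \<Rightarrow> real^'n \<Rightarrow> 'p set" where
  "cosupport D x = {i. (transpose D *v x) $ i = 0}"

definition cospace :: "real^'p^'n \<Rightarrow> 'p set \<Rightarrow> (real^'n) set" where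
  "cospace D J = ker_mat (transpose (sub_cols D J))"

definition H_cond :: "real^'n^'q \<Rightarrow> real^'p^'n \<Rightarrow> 'p set \<Rightarrow> bool" where
  "H_cond \<Phi> D J \<longleftrightarrow> ker_mat \<Phi> \<inter> cospace D J = {0}"


definition objective :: "real^'n^'q \<Rightarrow> real^'p^'n \<Rightarrow> real \<Rightarrow> real^'q \<Rightarrow> real^'n \<Rightarrow> real" where
  "objective \<Phi> D l y x = 1/2 * (norm (y - \<Phi> *v x))\<^sup>2 + l * norm1 (transpose D *v x)"

definition solution :: "real^'n^'q \<Rightarrow> real^'p^'n \<Rightarrow> real \<Rightarrow> real^'q \<Rightarrow> real^'n \<Rightarrow> bool" where
  "solution \<Phi> D l y x \<longleftrightarrow> (\<forall>x'. objective \<Phi> D l y x \<le> objective \<Phi> D l y x')"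

definition mu :: "real^'n^'q \<Rightarrow> real^'p^'n \<Rightarrow> real \<Rightarrow> real^'q \<Rightarrow> real^'q" where
  "mu \<Phi> D l y = (THE m. \<exists>x. solution \<Phi> D l y x \<and> m = \<Phi> *v x)"

definition df_hat :: "real^'n^'q \<Rightarrow> real^'p^'n \<Rightarrow> real^'q^'m \<Rightarrow> real \<Rightarrow> real^'q \<Rightarrow> real" where
  "df_hat \<Phi> D A l y = trace (A ** jacobian (mu \<Phi> D l) (at y) ** transpose A)"


definition basis_of :: "(real^'a) set \<Rightarrow> (real^'a) set \<Rightarrow> bool" where
  "basis_of G B \<longleftrightarrow> B \<subseteq> G \<and> independent B \<and> span B = G"

definition inverse_on :: "'b set \<Rightarrow> ('b \<Rightarrow> 'b \<Rightarrow> real) \<Rightarrow> ('b \<Rightarrow> 'b \<Rightarrow> real) \<Rightarrow> bool" where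
  "inverse_on B X Y \<longleftrightarrow> (\<forall>b\<in>B. \<forall>c\<in>B.
     (\<Sum>e\<in>B. X b e * Y e c) = (if b = c then 1 else 0) \<and>
     (\<Sum>e\<in>B. Y b e * X e c) = (if b = c then 1 else 0))"

text \<open>
  The columns of \<open>U_J\<close> are indexed by themselves, i.e. by a basis \<open>B\<close> of \<open>cospace D J\<close>, so that
  the entry of \<open>U_J\<^sup>* \<Phi>\<^sup>* \<Phi> U_J\<close> at \<open>b, c \<in> B\<close> is \<open>b \<bullet> (\<Phi>\<^sup>* \<Phi> c)\<close>. Under \<open>H_cond \<Phi> D J\<close> this matrix
  is invertible and \<open>A_op \<Phi> D J\<close> does not depend on the chosen basis; otherwise \<open>A_op \<Phi> D J\<close>
  carries no meaning. If \<open>cospace D J = {0}\<close>, then \<open>B = {}\<close> and \<open>A_op \<Phi> D J = 0\<close>.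
\<close>

definition gram :: "real^'n^'q \<Rightarrow> real^'n \<Rightarrow> real^'n \<Rightarrow> real" where
  "gram \<Phi> b c = b \<bullet> ((transpose \<Phi> ** \<Phi>) *v c)"

definition A_op :: "real^'n^'q \<Rightarrow> real^'p^'n \<Rightarrow> 'p set \<Rightarrow> real^'n^'n" where
  "A_op \<Phi> D J =
     (let B = (SOME B. basis_of (cospace D J) B);
          W = (SOME W. inverse_on B (gram \<Phi>) W)
      in \<chi> i j. \<Sum>b\<in>B. \<Sum>c\<in>B. b $ i * W b c * c $ j)"

definition Pi_op :: "real^'n^'q \<Rightarrow> real^'p^'n \<Rightarrow> 'p set \<Rightarrow> real^'q^'n" where
  "Pi_op \<Phi> D J = transpose \<Phi> ** (\<Phi> ** A_op \<Phi> D J ** transpose \<Phi> - mat 1)"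

definition Omega_op :: "real^'n^'q \<Rightarrow> real^'p^'n \<Rightarrow> 'p set \<Rightarrow> real^'p^'n" where
  "Omega_op \<Phi> D J = (transpose \<Phi> ** \<Phi> ** A_op \<Phi> D J - mat 1) ** sub_cols D (- J)"


definition H_piece :: "real^'n^'q \<Rightarrow> real^'p^'n \<Rightarrow> 'p set \<Rightarrow> 'p set \<Rightarrow> real^'p \<Rightarrow> real^'p
    \<Rightarrow> ((real^'q) \<times> real) set" where
  "H_piece \<Phi> D J K s \<sigma> = {(y, l). 0 \<le> l \<and>
     orth_proj (cospace D (J - K)) (Pi_op \<Phi> D J *v y) =
     l *\<^sub>R orth_proj (cospace D (J - K)) (Omega_op \<Phi> D J *v s - sub_cols D K *v \<sigma>)}"

definition H_set :: "real^'n^'q \<Rightarrow> real^'p^'n \<Rightarrow> ((real^'q) \<times> real) set" where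
  "H_set \<Phi> D =
     (\<Union>J \<in> {J. H_cond \<Phi> D J}.
      \<Union>K \<in> {K. K \<subseteq> J \<and> \<not> im_mat (Pi_op \<Phi> D J) \<subseteq> im_mat (sub_cols D (J - K))}.
      \<Union>s \<in> signs_on (- J). \<Union>\<sigma> \<in> signs_on K. H_piece \<Phi> D J K s \<sigma>)"

definition H_slice :: "real^'n^'q \<Rightarrow> real^'p^'n \<Rightarrow> real \<Rightarrow> (real^'q) set" where
  "H_slice \<Phi> D l = {y. (y, l) \<in> H_set \<Phi> D}"


text \<open>The two block rows of the linear system, with some multiplier \<open>\<nu>'\<close> indexed by \<open>J\<close>.\<close>

definition solves_system ::
    "real^'n^'q \<Rightarrow> real^'p^'n \<Rightarrow> 'p set \<Rightarrow> real^'q \<Rightarrow> real^'n \<Rightarrow> bool" where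
  "solves_system \<Phi> D J z \<nu> \<longleftrightarrow> (\<exists>\<nu>' \<in> vecs_on J.
     (transpose \<Phi> ** \<Phi>) *v \<nu> + sub_cols D J *v \<nu>' = transpose \<Phi> *v z \<and>
     transpose (sub_cols D J) *v \<nu> = 0)"

text \<open>The Lebesgue density of the standard normal distribution on \<open>real^'q\<close>.\<close>

definition std_normal_vec_density :: "real^'q \<Rightarrow> real" where
  "std_normal_vec_density z = exp (- (norm z)\<^sup>2 / 2) / sqrt (2 * pi) ^ CARD('q)"

end

theory Submission
  imports Defs
begin

text \<open>
  The expectation is linear algebra plus \<open>E[Z_i Z_j] = \<delta>_i_j\<close>. Under \<open>H_cond \<Phi> D J\<close> the operator
  \<open>A_op \<Phi> D J\<close> inverts the Gram form on \<open>cospace D J\<close>: \<open>A_op \<Phi> D J *v u\<close> is the only \<open>w\<close> in that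
  space with \<open>(\<Phi> v) \<bullet> (\<Phi> w) = v \<bullet> u\<close> for all \<open>v\<close> in it. The linear system says the same for
  \<open>u = \<Phi>\<^sup>* z\<close>, with the multiplier absorbing the part of the residual orthogonal to \<open>cospace D J\<close>. So
  \<open>\<nu> z = A_op \<Phi> D J \<Phi>\<^sup>* z\<close> is forced (\<open>solves_system_iff\<close>), the integrand is a quadratic form in
  \<open>Z\<close>, and its expectation is the trace of its matrix (\<open>std_normal_vec_quadratic_form\<close>), which is
  \<open>tr (A \<Phi> A_op \<Phi>\<^sup>* A\<^sup>*)\<close> by cyclicity.

  It remains to see that \<open>\<Phi> A_op \<Phi>\<^sup>*\<close> is the Jacobian of \<open>mu\<close> at \<open>y\<close> (\<open>jacobian_mu\<close>). Solutions
  are characterised by a dual vector \<open>q\<close> with \<open>\<bar>q_i\<bar> \<le> 1\<close>, equal to the sign of \<open>(D\<^sup>* x)_i\<close> off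
  the cosupport, such that \<open>\<Phi>\<^sup>*(y - \<Phi> x) = l D q\<close>. When \<open>y\<close> moves to \<open>y'\<close>, the candidate
  \<open>x' = x + A_op \<Phi>\<^sup>*(y' - y)\<close> stays in \<open>cospace D J\<close>, and its residual differs from the old one by
  \<open>- \<Pi>(y' - y)\<close>, where \<open>\<Pi> = Pi_op \<Phi> D J\<close>. This change has to be compensated in \<open>q\<close>, and only the
  coordinates in \<open>J\<close> with \<open>\<bar>q_i\<bar> < 1\<close> have room in both directions. With \<open>K\<close> the set of saturated
  coordinates in \<open>J\<close>, the optimality condition projected on \<open>cospace D (J - K)\<close> is the equation
  defining \<open>H_piece\<close>. As \<open>y\<close> lies outside \<open>H_slice\<close>, that piece cannot be part of \<open>H_set\<close>, which
  means that the image of \<open>\<Pi>\<close> is contained in the span of the columns in \<open>J - K\<close>. So the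
  compensation exists, and it is small for \<open>y'\<close> close to \<open>y\<close>. Hence \<open>x'\<close> solves the perturbed problem and \<open>mu\<close> is affine near \<open>y\<close>.
\<close>

text \<open>
  Transposed products are kept in the form \<open>transpose M *v u\<close> of the definitions; the simplifier
  would turn them into \<open>u v* M\<close>.
\<close>

declare transpose_matrix_vector [simp del]

section \<open>Projections, images and kernels\<close>

lemma inner_transpose_mult:
  fixes M :: "real^'a^'b"
  shows "(transpose M *v u) \<bullet> v = u \<bullet> (M *v v)"
  by (metis dot_lmul_matrix transpose_matrix_vector)

lemma orth_proj_decomposition:
  assumes "subspace G"
  shows "orth_proj G u \<in> G" "u - orth_proj G u \<in> G\<^sup>\<bottom>"
proof -
  obtain a b where a: "a \<in> G" and b: "b \<in> G\<^sup>\<bottom>" and u: "u = a + b"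
    using subspace_sum_orthogonal_comp[OF assms] by (metis UNIV_I set_plus_elim)
  have "\<exists>!p. p \<in> G \<and> u - p \<in> G\<^sup>\<bottom>"
  proof (rule ex1I[of _ a])
    show "a \<in> G \<and> u - a \<in> G\<^sup>\<bottom>"
      using a b u by simp
  next
    fix p assume p: "p \<in> G \<and> u - p \<in> G\<^sup>\<bottom>"
    have d: "p - a \<in> G"
      using p a assms by (simp add: subspace_diff)
    have "(p - a) \<bullet> (u - p) = 0" "(p - a) \<bullet> b = 0"
      using p b d by (auto simp: orthogonal_comp_def orthogonal_def)
    moreover have "p - a = b - (u - p)"
      using u by simp
    ultimately have "(p - a) \<bullet> (p - a) = 0"
      by (metis inner_diff_right diff_self)
    then show "p = a" by simp
  qed
  from theI'[OF this] show "orth_proj G u \<in> G" "u - orth_proj G u \<in> G\<^sup>\<bottom>"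
    by (auto simp: orth_proj_def)
qed

lemma orth_proj_unique:
  assumes "subspace G" "p \<in> G" "u - p \<in> G\<^sup>\<bottom>"
  shows "orth_proj G u = p"
proof -
  let ?q = "orth_proj G u"
  note q = orth_proj_decomposition[OF assms(1), of u]
  have d: "?q - p \<in> G"
    using q assms by (simp add: subspace_diff)
  have "(?q - p) \<bullet> (u - p) = 0" "(?q - p) \<bullet> (u - ?q) = 0"
    using q assms(3) d by (auto simp: orthogonal_comp_def orthogonal_def)
  moreover have "?q - p = (u - p) - (u - ?q)"
    by simp
  ultimately have "(?q - p) \<bullet> (?q - p) = 0"
    by (metis inner_diff_right diff_self)
  then show ?thesis by simp
qed

lemma orth_proj_eq_scaled:
  assumes G: "subspace G" and "u - l *\<^sub>R w \<in> G\<^sup>\<bottom>"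
  shows "orth_proj G u = l *\<^sub>R orth_proj G w"
proof (rule orth_proj_unique[OF G])
  note w = orth_proj_decomposition[OF G, of w]
  show "l *\<^sub>R orth_proj G w \<in> G"
    using w G by (simp add: subspace_scale)
  have "u - l *\<^sub>R orth_proj G w = (u - l *\<^sub>R w) + l *\<^sub>R (w - orth_proj G w)"
    by (simp add: algebra_simps)
  also have "\<dots> \<in> G\<^sup>\<bottom>"
    using assms(2) w subspace_orthogonal_comp[of G] by (simp add: subspace_add subspace_scale)
  finally show "u - l *\<^sub>R orth_proj G w \<in> G\<^sup>\<bottom>" .
qed

text \<open>
  The inclusion \<open>(Ker M\<^sup>*)\<^sup>\<bottom> \<subseteq> Im M\<close>: the component of \<open>r\<close> orthogonal to \<open>Im M\<close> lies in
  \<open>Ker M\<^sup>*\<close>, hence is orthogonal to \<open>r\<close> and to itself.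
\<close>

lemma in_range_if_orthogonal_to_kernel_transpose:
  fixes M :: "real^'b^'a"
  assumes "\<And>v. transpose M *v v = 0 \<Longrightarrow> v \<bullet> r = 0"
  shows "\<exists>u. r = M *v u"
proof -
  have "subspace (range ((*v) M))"
    by (simp add: linear_subspace_image)
  then obtain a b where a: "a \<in> range ((*v) M)" and b: "b \<in> (range ((*v) M))\<^sup>\<bottom>" and r: "r = a + b"
    using subspace_sum_orthogonal_comp by (metis UNIV_I set_plus_elim)
  have orth: "(M *v u) \<bullet> b = 0" for u
    using b by (auto simp: orthogonal_comp_def orthogonal_def)
  have "(transpose M *v b) \<bullet> (transpose M *v b) = 0"
    using orth by (metis inner_commute inner_transpose_mult)
  then have "b \<bullet> r = 0"
    by (intro assms) simp
  then have "b \<bullet> b = 0"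
    using r orth a by (auto simp: inner_add_right inner_commute)
  then show ?thesis
    using a r by auto
qed

section \<open>Column submatrices and the cospace\<close>

lemma sub_cols_mult: "sub_cols D J *v v = D *v (\<chi> i. if i \<in> J then v $ i else 0)"
  by (simp add: vec_eq_iff matrix_vector_mult_def sub_cols_def)
     (auto intro!: sum.cong)

lemma sub_cols_mult_restrict:
  "sub_cols D I *v (\<chi> i. if i \<in> I then v $ i else 0) = sub_cols D I *v v"
  unfolding sub_cols_mult by (rule arg_cong[of _ _ "(*v) D"]) (simp add: vec_eq_iff)

lemma sub_cols_mult_disjoint_union:
  assumes "I \<inter> K = {}"
  shows "sub_cols D (I \<union> K) *v v = sub_cols D I *v v + sub_cols D K *v v"
proof -
  have "sub_cols D (I \<union> K) = sub_cols D I + sub_cols D K"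
    using assms by (auto simp: vec_eq_iff sub_cols_def)
  then show ?thesis
    by (simp add: matrix_vector_mult_add_rdistrib)
qed

lemma sub_cols_UNIV: "sub_cols D UNIV = D"
  by (simp add: vec_eq_iff sub_cols_def)

lemma transpose_sub_cols_mult:
  "(transpose (sub_cols D J) *v v) $ i = (if i \<in> J then (transpose D *v v) $ i else 0)"
  by (simp add: matrix_vector_mult_def sub_cols_def transpose_def)

lemma mem_cospace: "v \<in> cospace D J \<longleftrightarrow> (\<forall>i\<in>J. (transpose D *v v) $ i = 0)"
  by (auto simp: cospace_def ker_mat_def vec_eq_iff transpose_sub_cols_mult)

lemma subspace_cospace: "subspace (cospace D J)"
  by (auto simp: subspace_def mem_cospace matrix_vector_right_distrib
      matrix_vector_mult_scaleR)

lemma cospace_orthogonal_sub_cols: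
  "v \<in> cospace D J \<Longrightarrow> v \<bullet> (sub_cols D J *v u) = 0"
  by (simp add: inner_transpose_mult[symmetric] cospace_def ker_mat_def)

section \<open>The restricted inverse of the Gram operator\<close>

lemma inner_gram_mult:
  fixes \<Phi> :: "real^'n^'q"
  shows "v \<bullet> ((transpose \<Phi> ** \<Phi>) *v w) = (\<Phi> *v v) \<bullet> (\<Phi> *v w)"
  by (metis inner_transpose_mult inner_commute matrix_vector_mul_assoc)

lemma gram_eq: "gram \<Phi> b c = (\<Phi> *v b) \<bullet> (\<Phi> *v c)"
  by (simp add: gram_def inner_gram_mult)

lemma H_cond_zero:
  assumes "H_cond \<Phi> D J" "v \<in> cospace D J" "\<Phi> *v v = 0"
  shows "v = 0"
  using assms by (auto simp: H_cond_def ker_mat_def)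

text \<open>
  \<open>H_cond\<close> makes \<open>\<Phi>\<close> injective on the cospace, so \<open>\<Phi>\<close> carries the basis \<open>B\<close> to an independent
  set. The column of the inverse indexed by \<open>c\<close> holds the coordinates of a vector \<open>w\<close> with
  \<open>(\<Phi> b) \<bullet> (\<Phi> w) = \<delta>_b_c\<close>: represent the functional dual to \<open>\<Phi> c\<close> by a vector, project it on
  the image of the cospace, and pull the projection back. This yields a right inverse; the symmetry
  of the Gram matrix makes it symmetric and therefore two-sided.
\<close>

lemma gram_inverse_exists:
  fixes \<Phi> :: "real^'n^'q"
  assumes H: "H_cond \<Phi> D J" and B: "basis_of (cospace D J) B"
  shows "\<exists>W. inverse_on B (gram \<Phi>) W"
proof -
  let ?G = "cospace D J"
  have BG: "B \<subseteq> ?G" and ind: "independent B" and sp: "span B = ?G"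
    using B by (auto simp: basis_of_def)
  have fin: "finite B"
    using ind independent_bound by blast
  have inj: "inj_on ((*v) \<Phi>) (span B)"
  proof (rule inj_onI)
    fix u v assume "u \<in> span B" "v \<in> span B" "\<Phi> *v u = \<Phi> *v v"
    then have "u - v \<in> ?G" "\<Phi> *v (u - v) = 0"
      by (simp_all add: sp subspace_diff subspace_cospace matrix_vector_mult_diff_distrib)
    then show "u = v"
      using H_cond_zero[OF H] by fastforce
  qed
  have indI: "independent ((*v) \<Phi> ` B)"
    using ind inj by (intro linear_independent_injective_image) auto
  have "\<exists>w\<in>?G. \<forall>b\<in>B. (\<Phi> *v b) \<bullet> (\<Phi> *v w) = (if b = c then 1 else 0)" if c: "c \<in> B" for c
  proof -
    obtain f :: "real^'q \<Rightarrow> real"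
      where f: "linear f" "\<forall>u\<in>(*v) \<Phi> ` B. f u = (if u = \<Phi> *v c then 1 else 0)"
      using linear_independent_extend[OF indI, of "\<lambda>u. if u = \<Phi> *v c then 1 else 0"] by blast
    let ?u = "adjoint f 1"
    have fu: "f u = u \<bullet> ?u" for u
      using adjoint_works[OF f(1), of u 1] by simp
    have S: "subspace ((*v) \<Phi> ` ?G)"
      by (simp add: linear_subspace_image subspace_cospace)
    note p = orth_proj_decomposition[OF S, of ?u]
    from p(1) obtain w where w: "w \<in> ?G" "orth_proj ((*v) \<Phi> ` ?G) ?u = \<Phi> *v w"
      by auto
    have "(\<Phi> *v b) \<bullet> (\<Phi> *v w) = (if b = c then 1 else 0)" if b: "b \<in> B" for b
    proof -
      have "(\<Phi> *v b) \<bullet> (?u - \<Phi> *v w) = 0"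
        using p(2) w b BG by (auto simp: orthogonal_comp_def orthogonal_def)
      then have "(\<Phi> *v b) \<bullet> (\<Phi> *v w) = f (\<Phi> *v b)"
        by (simp add: fu inner_diff_right)
      also have "\<dots> = (if \<Phi> *v b = \<Phi> *v c then 1 else 0)"
        using f(2) b by auto
      also have "\<dots> = (if b = c then 1 else 0)"
        using inj b c by (auto simp: inj_on_def span_base)
      finally show ?thesis .
    qed
    with w show ?thesis by blast
  qed
  then obtain w where w: "\<And>c. c \<in> B \<Longrightarrow> w c \<in> ?G"
      "\<And>b c. b \<in> B \<Longrightarrow> c \<in> B \<Longrightarrow> (\<Phi> *v b) \<bullet> (\<Phi> *v w c) = (if b = c then 1 else 0)"
    by metis
  have "\<forall>c\<in>B. \<exists>t. w c = (\<Sum>e\<in>B. t e *\<^sub>R e)"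
    using w(1) sp span_finite[OF fin] by auto
  then obtain t where t: "\<And>c. c \<in> B \<Longrightarrow> w c = (\<Sum>e\<in>B. t c e *\<^sub>R e)"
    by metis
  define W where "W e c = t c e" for e c
  have XW: "(\<Sum>e\<in>B. gram \<Phi> b e * W e c) = (if b = c then 1 else 0)"
    if "b \<in> B" "c \<in> B" for b c
  proof -
    have "(\<Sum>e\<in>B. gram \<Phi> b e * W e c) = (\<Phi> *v b) \<bullet> (\<Phi> *v (\<Sum>e\<in>B. t c e *\<^sub>R e))"
      by (simp add: gram_eq W_def inner_sum_right linear_sum[OF matrix_vector_mul_linear]
          matrix_vector_mult_scaleR mult.commute)
    then show ?thesis
      using w(2)[OF that] t[OF that(2)] by simp
  qed
  have sym: "W b c = W c b" if bc: "b \<in> B" "c \<in> B" for b c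
  proof -
    have "W b c = (\<Sum>e\<in>B. W e c * (if e = b then 1 else 0))"
      using bc fin by (simp add: mult_delta_left mult_delta_right)
    also have "\<dots> = (\<Sum>e\<in>B. W e c * (\<Sum>a\<in>B. gram \<Phi> e a * W a b))"
      using bc by (intro sum.cong) (auto simp: XW)
    also have "\<dots> = (\<Sum>a\<in>B. (\<Sum>e\<in>B. gram \<Phi> a e * W e c) * W a b)"
      by (simp only: sum_distrib_left sum_distrib_right, subst sum.swap)
         (simp add: mult_ac gram_eq inner_commute)
    also have "\<dots> = (\<Sum>a\<in>B. (if a = c then 1 else 0) * W a b)"
      using bc by (intro sum.cong) (auto simp: XW)
    also have "\<dots> = W c b"
      using bc fin by (simp add: mult_delta_left mult_delta_right)
    finally show ?thesis .
  qed
  have WX: "(\<Sum>e\<in>B. W b e * gram \<Phi> e c) = (if b = c then 1 else 0)"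
    if "b \<in> B" "c \<in> B" for b c
  proof -
    have "(\<Sum>e\<in>B. W b e * gram \<Phi> e c) = (\<Sum>e\<in>B. gram \<Phi> c e * W e b)"
      using that by (intro sum.cong) (auto simp: sym gram_eq inner_commute)
    then show ?thesis
      using XW[OF that(2,1)] by auto
  qed
  show ?thesis
    using XW WX by (auto simp: inverse_on_def intro!: exI[of _ W])
qed

text \<open>
  This characterisation replaces the definition of \<open>A_op\<close> from here on; in particular it makes the
  choice of the basis irrelevant.
\<close>

lemma A_op_variational:
  fixes \<Phi> :: "real^'n^'q"
  assumes H: "H_cond \<Phi> D J"
  shows "A_op \<Phi> D J *v u \<in> cospace D J"
    and "v \<in> cospace D J \<Longrightarrow> (\<Phi> *v v) \<bullet> (\<Phi> *v (A_op \<Phi> D J *v u)) = v \<bullet> u"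
proof -
  let ?G = "cospace D J"
  define B where "B = (SOME B. basis_of ?G B)"
  define W where "W = (SOME W. inverse_on B (gram \<Phi>) W)"
  have "\<exists>B. basis_of ?G B"
    using basis_subspace_exists[OF subspace_cospace[of D J]] unfolding basis_of_def by metis
  then have B: "basis_of ?G B"
    unfolding B_def by (rule someI_ex)
  have W: "inverse_on B (gram \<Phi>) W"
    unfolding W_def using gram_inverse_exists[OF H B] by (rule someI_ex)
  have BG: "B \<subseteq> ?G" and sp: "span B = ?G" and ind: "independent B"
    using B by (auto simp: basis_of_def)
  have fin: "finite B"
    using ind independent_bound by blast
  have XW: "(\<Sum>b\<in>B. gram \<Phi> e b * W b c) = (if e = c then 1 else 0)" if "e \<in> B" "c \<in> B" for e c
    using W that unfolding inverse_on_def by blast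
  have A: "A_op \<Phi> D J = (\<chi> i j. \<Sum>b\<in>B. \<Sum>c\<in>B. b $ i * W b c * c $ j)"
    unfolding A_op_def Let_def B_def[symmetric] W_def[symmetric] by simp
  have Au: "A_op \<Phi> D J *v u = (\<Sum>b\<in>B. (\<Sum>c\<in>B. W b c * (c \<bullet> u)) *\<^sub>R b)"
  proof -
    have "(A_op \<Phi> D J *v u) $ i = (\<Sum>b\<in>B. (\<Sum>c\<in>B. W b c * (c \<bullet> u)) * b $ i)" for i
    proof -
      have "(A_op \<Phi> D J *v u) $ i
          = (\<Sum>j\<in>UNIV. \<Sum>b\<in>B. \<Sum>c\<in>B. b $ i * W b c * c $ j * u $ j)"
        by (simp add: A matrix_vector_mult_def sum_distrib_right)
      also have "\<dots> = (\<Sum>b\<in>B. \<Sum>c\<in>B. \<Sum>j\<in>UNIV. b $ i * W b c * c $ j * u $ j)"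
        by (subst sum.swap, intro sum.cong refl, subst sum.swap, simp)
      also have "\<dots> = (\<Sum>b\<in>B. (\<Sum>c\<in>B. W b c * (c \<bullet> u)) * b $ i)"
        by (simp add: inner_vec_def sum_distrib_left sum_distrib_right mult_ac)
      finally show ?thesis .
    qed
    then show ?thesis
      by (simp add: vec_eq_iff)
  qed
  show "A_op \<Phi> D J *v u \<in> ?G"
    unfolding Au using BG by (intro subspace_sum subspace_scale subspace_cospace) auto
  have basis: "(\<Phi> *v e) \<bullet> (\<Phi> *v (A_op \<Phi> D J *v u)) = e \<bullet> u" if e: "e \<in> B" for e
  proof -
    have "(\<Phi> *v e) \<bullet> (\<Phi> *v (A_op \<Phi> D J *v u))
        = (\<Sum>b\<in>B. (\<Sum>c\<in>B. W b c * (c \<bullet> u)) * gram \<Phi> e b)"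
      by (simp add: Au gram_eq inner_sum_right linear_sum[OF matrix_vector_mul_linear]
          matrix_vector_mult_scaleR)
    also have "\<dots> = (\<Sum>c\<in>B. (\<Sum>b\<in>B. gram \<Phi> e b * W b c) * (c \<bullet> u))"
      by (simp only: sum_distrib_right, subst sum.swap) (simp add: mult_ac)
    also have "\<dots> = (\<Sum>c\<in>B. (if e = c then 1 else 0) * (c \<bullet> u))"
      by (intro sum.cong refl) (simp only: XW[OF e])
    also have "\<dots> = e \<bullet> u"
      using e fin by (simp add: mult_delta_left)
    finally show ?thesis .
  qed
  assume "v \<in> ?G"
  then have "v \<in> span B" by (simp add: sp)
  then show "(\<Phi> *v v) \<bullet> (\<Phi> *v (A_op \<Phi> D J *v u)) = v \<bullet> u"
    by (induction rule: span_induct_alt)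
       (simp_all add: basis matrix_vector_right_distrib matrix_vector_mult_scaleR inner_add_left)
qed

lemma A_op_unique:
  fixes \<Phi> :: "real^'n^'q"
  assumes H: "H_cond \<Phi> D J" and w: "w \<in> cospace D J"
    and eq: "\<And>v. v \<in> cospace D J \<Longrightarrow> (\<Phi> *v v) \<bullet> (\<Phi> *v w) = v \<bullet> u"
  shows "w = A_op \<Phi> D J *v u"
proof -
  let ?d = "w - A_op \<Phi> D J *v u"
  have d: "?d \<in> cospace D J"
    using w A_op_variational(1)[OF H] by (simp add: subspace_diff subspace_cospace)
  have "(\<Phi> *v ?d) \<bullet> (\<Phi> *v ?d) = (\<Phi> *v ?d) \<bullet> (\<Phi> *v w) - (\<Phi> *v ?d) \<bullet> (\<Phi> *v (A_op \<Phi> D J *v u))"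
    by (simp add: matrix_vector_mult_diff_distrib inner_diff_right)
  also have "\<dots> = 0"
    by (simp only: eq[OF d] A_op_variational(2)[OF H d])
  finally have "?d = 0"
    using H_cond_zero[OF H d] by simp
  then show ?thesis by simp
qed

text \<open>
  The first block row, tested against \<open>cospace D J\<close>, loses its multiplier and becomes the equation
  that determines \<open>A_op\<close>. Conversely the residual of that equation is orthogonal to
  \<open>Ker D_J\<^sup>*\<close>, so it is a combination of the columns in \<open>J\<close>, which supplies the multiplier.
\<close>

lemma solves_system_iff:
  fixes \<Phi> :: "real^'n^'q"
  assumes H: "H_cond \<Phi> D J"
  shows "solves_system \<Phi> D J z \<nu> \<longleftrightarrow> \<nu> = A_op \<Phi> D J *v (transpose \<Phi> *v z)"
proof
  assume "solves_system \<Phi> D J z \<nu>"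
  then obtain \<nu>' where 1: "(transpose \<Phi> ** \<Phi>) *v \<nu> + sub_cols D J *v \<nu>' = transpose \<Phi> *v z"
    and 2: "\<nu> \<in> cospace D J"
    by (auto simp: solves_system_def cospace_def ker_mat_def)
  show "\<nu> = A_op \<Phi> D J *v (transpose \<Phi> *v z)"
  proof (rule A_op_unique[OF H 2])
    fix v assume v: "v \<in> cospace D J"
    show "(\<Phi> *v v) \<bullet> (\<Phi> *v \<nu>) = v \<bullet> (transpose \<Phi> *v z)"
      unfolding 1[symmetric] inner_add_right
      using cospace_orthogonal_sub_cols[OF v] by (simp add: inner_gram_mult)
  qed
next
  assume \<nu>: "\<nu> = A_op \<Phi> D J *v (transpose \<Phi> *v z)"
  let ?r = "transpose \<Phi> *v z - (transpose \<Phi> ** \<Phi>) *v \<nu>"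
  have "\<exists>u. ?r = sub_cols D J *v u"
  proof (rule in_range_if_orthogonal_to_kernel_transpose)
    fix v assume "transpose (sub_cols D J) *v v = 0"
    then have "v \<in> cospace D J"
      by (simp add: cospace_def ker_mat_def)
    then show "v \<bullet> ?r = 0"
      unfolding inner_diff_right inner_gram_mult \<nu> by (simp only: A_op_variational(2)[OF H])
  qed
  then obtain u where u: "?r = sub_cols D J *v u" ..
  let ?u = "\<chi> i. if i \<in> J then u $ i else 0"
  have "sub_cols D J *v ?u = ?r"
    unfolding u by (rule sub_cols_mult_restrict)
  moreover have "?u \<in> vecs_on J"
    by (simp add: vecs_on_def)
  moreover have "transpose (sub_cols D J) *v \<nu> = 0"
    using A_op_variational(1)[OF H] \<nu> unfolding cospace_def ker_mat_def by blast
  ultimately show "solves_system \<Phi> D J z \<nu>"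
    unfolding solves_system_def by (metis add.commute diff_add_cancel)
qed

section \<open>Optimality certificates for the analysis problem\<close>

text \<open>
  The first-order condition: \<open>q\<close> is a subgradient of the 1-norm at \<open>D\<^sup>* x\<close>. The product
  condition encodes \<open>q_i = sgn (D\<^sup>* x)_i\<close> wherever \<open>(D\<^sup>* x)_i \<noteq> 0\<close> and is void elsewhere.
\<close>

definition certificate ::
    "real^'n^'q \<Rightarrow> real^'p^'n \<Rightarrow> real \<Rightarrow> real^'q \<Rightarrow> real^'n \<Rightarrow> real^'p \<Rightarrow> bool" where
  "certificate \<Phi> D l y x q \<longleftrightarrow>
    (\<forall>i. \<bar>q $ i\<bar> \<le> 1 \<and> q $ i * (transpose D *v x) $ i = \<bar>(transpose D *v x) $ i\<bar>) \<and>
    transpose \<Phi> *v (y - \<Phi> *v x) = l *\<^sub>R (D *v q)"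

lemma norm1_eq_inner:
  assumes "\<And>i. q $ i * c $ i = \<bar>c $ i\<bar>"
  shows "norm1 c = q \<bullet> c"
  using assms by (simp add: norm1_def inner_vec_def)

lemma inner_le_norm1:
  assumes "\<And>i. \<bar>q $ i\<bar> \<le> 1"
  shows "q \<bullet> c \<le> norm1 c"
  unfolding norm1_def inner_vec_def
proof (rule sum_mono)
  fix i
  have "q $ i * c $ i \<le> \<bar>q $ i\<bar> * \<bar>c $ i\<bar>"
    by (metis abs_ge_self abs_mult)
  also have "\<dots> \<le> 1 * \<bar>c $ i\<bar>"
    using assms by (intro mult_right_mono) auto
  finally show "q $ i \<bullet> c $ i \<le> \<bar>c $ i\<bar>"
    by simp
qed

lemma objective_shift:
  "objective \<Phi> D l y (x + h) = objective \<Phi> D l y x + (norm (\<Phi> *v h))\<^sup>2 / 2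
    - (transpose \<Phi> *v (y - \<Phi> *v x)) \<bullet> h
    + l * (norm1 (transpose D *v (x + h)) - norm1 (transpose D *v x))"
proof -
  have "y - \<Phi> *v (x + h) = (y - \<Phi> *v x) - \<Phi> *v h"
    by (simp add: matrix_vector_right_distrib)
  then have "(norm (y - \<Phi> *v (x + h)))\<^sup>2
      = (norm (y - \<Phi> *v x))\<^sup>2 - 2 * ((y - \<Phi> *v x) \<bullet> (\<Phi> *v h)) + (norm (\<Phi> *v h))\<^sup>2"
    by (simp only: power2_norm_eq_inner) (simp add: inner_diff inner_commute)
  then show ?thesis
    by (simp add: objective_def inner_transpose_mult algebra_simps)
qed

text \<open>
  The map \<open>c \<mapsto> q \<bullet> c\<close> is a minorant of the 1-norm that is tight at \<open>D\<^sup>* x\<close>. Replacing the norm by it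
  leaves a convex quadratic function of \<open>x\<close>, and stationarity says that its gradient vanishes.
\<close>

lemma certificate_imp_solution:
  assumes cert: "certificate \<Phi> D l y x q" and l: "l \<ge> 0"
  shows "solution \<Phi> D l y x"
  unfolding solution_def
proof
  fix x'
  let ?h = "x' - x"
  from cert have q: "\<And>i. \<bar>q $ i\<bar> \<le> 1"
    "\<And>i. q $ i * (transpose D *v x) $ i = \<bar>(transpose D *v x) $ i\<bar>"
    and g: "transpose \<Phi> *v (y - \<Phi> *v x) = l *\<^sub>R (D *v q)"
    by (auto simp: certificate_def)
  have "(D *v q) \<bullet> ?h = q \<bullet> (transpose D *v x') - q \<bullet> (transpose D *v x)"
    by (metis inner_commute inner_transpose_mult inner_diff_right matrix_vector_mult_diff_distrib)
  also have "\<dots> \<le> norm1 (transpose D *v x') - norm1 (transpose D *v x)"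
    using inner_le_norm1[OF q(1)] norm1_eq_inner[OF q(2)] by simp
  finally have "l * ((D *v q) \<bullet> ?h) \<le> l * (norm1 (transpose D *v x') - norm1 (transpose D *v x))"
    using l by (rule mult_left_mono)
  moreover have "objective \<Phi> D l y x' = objective \<Phi> D l y x + (norm (\<Phi> *v ?h))\<^sup>2 / 2
      - l * ((D *v q) \<bullet> ?h) + l * (norm1 (transpose D *v x') - norm1 (transpose D *v x))"
    using objective_shift[of \<Phi> D l y x ?h] g by simp
  ultimately show "objective \<Phi> D l y x \<le> objective \<Phi> D l y x'"
    by simp
qed

text \<open>
  The absolute value is linear on an initial segment of every ray; its slope there is \<open>s\<close> times that
  of the ray.
\<close>

lemma abs_along_ray:
  fixes c k :: real
  assumes "s = (if c = 0 then sgn k else sgn c)"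
  shows "\<forall>\<^sub>F t in at_right 0. s * (c + t * k) = \<bar>c + t * k\<bar>"
proof -
  have lim: "((\<lambda>t. c + t * k) \<longlongrightarrow> c) (at_right 0)"
    by (auto intro!: tendsto_eq_intros)
  consider "c = 0" | "c > 0" | "c < 0" by linarith
  then show ?thesis
  proof cases
    case 1
    have "\<forall>\<^sub>F t::real in at_right 0. t > 0"
      by (simp add: eventually_at_right_less)
    then show ?thesis
      by eventually_elim (use 1 assms in \<open>auto simp: sgn_if abs_mult\<close>)
  next
    case 2
    from order_tendstoD(1)[OF lim 2] show ?thesis
      by eventually_elim (use 2 assms in auto)
  next
    case 3
    from order_tendstoD(2)[OF lim 3] show ?thesis
      by eventually_elim (use 3 assms in auto)
  qed
qed

text \<open>
  If no certificate exists, \<open>\<Phi>\<^sup>*(y - \<Phi> x) / l\<close> lies outside the compact convex set of the vectors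
  \<open>D q\<close> with \<open>q\<close> a subgradient at \<open>D\<^sup>* x\<close>. A separating direction \<open>h\<close> is then a descent direction:
  along it, the 1-norm grows at the rate of the subgradient that is extremal for \<open>h\<close>, which is too
  slow to make up for the decrease of the quadratic part.
\<close>

lemma solution_imp_certificate:
  fixes \<Phi> :: "real^'n^'q" and D :: "real^'p^'n"
  assumes l: "l > 0" and sol: "solution \<Phi> D l y x"
  shows "\<exists>q. certificate \<Phi> D l y x q"
proof -
  define c where "c = transpose D *v x"
  define g where "g = transpose \<Phi> *v (y - \<Phi> *v x)"
  define B :: "(real^'p) set" where "B = {q. \<forall>i. \<bar>q $ i\<bar> \<le> 1 \<and> q $ i * c $ i = \<bar>c $ i\<bar>}"
  have "closed B"
    unfolding B_def
    by (intro closed_Collect_all closed_Collect_conj closed_Collect_le closed_Collect_eq continuous_intros)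
  moreover have "B \<subseteq> cbox (\<chi> i. -1) (\<chi> i. 1)"
    by (auto simp: B_def mem_box_cart abs_le_iff minus_le_iff)
  ultimately have "compact B"
    by (meson bounded_cbox bounded_subset compact_eq_bounded_closed)
  then have "closed ((*v) D ` B)"
    by (intro compact_imp_closed compact_continuous_image matrix_vector_mult_linear_continuous_on)
  moreover have "convex B"
  proof (rule convexI)
    fix p q :: "real^'p" and u v :: real
    assume p: "p \<in> B" and q: "q \<in> B" and uv: "0 \<le> u" "0 \<le> v" "u + v = 1"
    have "\<bar>u * p $ i + v * q $ i\<bar> \<le> 1" for i
    proof -
      have "\<bar>u * p $ i + v * q $ i\<bar> \<le> u * \<bar>p $ i\<bar> + v * \<bar>q $ i\<bar>"
        using uv by (metis abs_mult abs_of_nonneg abs_triangle_ineq)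
      also have "\<dots> \<le> u * 1 + v * 1"
        using p q uv by (intro add_mono mult_left_mono) (auto simp: B_def)
      finally show ?thesis using uv by simp
    qed
    moreover have "(u * p $ i + v * q $ i) * c $ i = \<bar>c $ i\<bar>" for i
    proof -
      have "(u * p $ i + v * q $ i) * c $ i = u * (p $ i * c $ i) + v * (q $ i * c $ i)"
        by (simp add: algebra_simps)
      also have "\<dots> = (u + v) * \<bar>c $ i\<bar>"
        using p q by (simp add: B_def algebra_simps)
      finally show ?thesis using uv by simp
    qed
    ultimately show "u *\<^sub>R p + v *\<^sub>R q \<in> B"
      by (simp add: B_def)
  qed
  then have "convex ((*v) D ` B)"
    by (intro convex_linear_image) auto
  moreover have "(1 / l) *\<^sub>R g \<in> (*v) D ` B"
  proof (rule ccontr)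
    assume "(1 / l) *\<^sub>R g \<notin> (*v) D ` B"
    then obtain a b where a: "a \<bullet> ((1 / l) *\<^sub>R g) < b" and b: "\<And>q. q \<in> B \<Longrightarrow> b < a \<bullet> (D *v q)"
      using separating_hyperplane_closed_point[OF calculation(2,1)] by blast
    define h where "h = - a"
    define k where "k = transpose D *v h"
    \<comment> \<open>where \<open>c\<close> vanishes, \<open>q\<close> is free in \<open>[-1, 1]\<close>; following the sign of \<open>k\<close> maximises \<open>q \<bullet> k\<close>\<close>
    define q :: "real^'p" where "q = (\<chi> i. if c $ i = 0 then sgn (k $ i) else sgn (c $ i))"
    have "q \<in> B"
      by (auto simp: B_def q_def sgn_if abs_if)
    from b[OF this] a have "(1 / l) * (g \<bullet> h) > (D *v q) \<bullet> h"
      by (simp add: h_def inner_commute)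
    moreover have Dq: "(D *v q) \<bullet> h = q \<bullet> k"
      unfolding k_def by (metis inner_commute inner_transpose_mult)
    ultimately have slope: "g \<bullet> h - l * (q \<bullet> k) > 0" (is "?\<delta> > 0")
      using l by (simp add: field_simps)
    let ?N = "(norm (\<Phi> *v h))\<^sup>2"
    have "((\<lambda>t. t * ?N / 2) \<longlongrightarrow> 0) (at_right 0)"
      by (auto intro!: tendsto_eq_intros)
    from order_tendstoD(2)[OF this slope]
    have "\<forall>\<^sub>F t in at_right 0. t * ?N / 2 < ?\<delta>" .
    moreover have "\<forall>\<^sub>F t::real in at_right 0. t > 0"
      by (simp add: eventually_at_right_less)
    moreover have "\<forall>\<^sub>F t in at_right 0. \<forall>i. q $ i * (c $ i + t * k $ i) = \<bar>c $ i + t * k $ i\<bar>"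
      by (intro eventually_all_finite abs_along_ray) (simp add: q_def)
    ultimately have "\<forall>\<^sub>F t in at_right 0. objective \<Phi> D l y (x + t *\<^sub>R h) < objective \<Phi> D l y x"
    proof eventually_elim
      case (elim t)
      have ck: "transpose D *v (x + t *\<^sub>R h) = c + t *\<^sub>R k"
        by (simp add: c_def k_def matrix_vector_right_distrib matrix_vector_mult_scaleR)
      have "norm1 (c + t *\<^sub>R k) = q \<bullet> (c + t *\<^sub>R k)"
        using elim(3) by (intro norm1_eq_inner) simp
      moreover have "norm1 c = q \<bullet> c"
        using \<open>q \<in> B\<close> by (intro norm1_eq_inner) (simp add: B_def)
      ultimately have "norm1 (transpose D *v (x + t *\<^sub>R h)) - norm1 (transpose D *v x) = t * (q \<bullet> k)"
        by (simp only: ck c_def[symmetric]) (simp add: inner_add_right)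
      then have "objective \<Phi> D l y (x + t *\<^sub>R h)
          = objective \<Phi> D l y x + t * (t * ?N / 2 - ?\<delta>)"
        unfolding objective_shift g_def[symmetric]
        by (simp add: matrix_vector_mult_scaleR power_mult_distrib power2_eq_square algebra_simps)
      moreover have "t * (t * ?N / 2 - ?\<delta>) < 0"
        using elim(1,2) by (simp add: mult_pos_neg)
      ultimately show ?case by linarith
    qed
    then obtain t where "objective \<Phi> D l y (x + t *\<^sub>R h) < objective \<Phi> D l y x"
      using eventually_happens'[of "at_right (0::real)"] by (metis trivial_limit_at_right_real)
    then show False
      using sol by (meson solution_def not_le)
  qed
  then obtain q where "q \<in> B" "(1 / l) *\<^sub>R g = D *v q" by auto
  moreover from this(2) have "g = l *\<^sub>R (D *v q)"
    using l by (metis divide_self_if less_numeral_extra(3) scaleR_one scaleR_scaleR times_divide_eq_right mult.right_neutral)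
  ultimately show ?thesis
    by (auto simp: certificate_def B_def c_def g_def)
qed

text \<open>
  The subdifferential of the 1-norm is monotone; pairing the difference of the two stationarity
  equations with \<open>x1 - x2\<close> gives \<open>0 \<le> - \<parallel>\<Phi> (x1 - x2)\<parallel>\<^sup>2\<close>.
\<close>

lemma solution_image_unique:
  assumes l: "l > 0" and "solution \<Phi> D l y x1" "solution \<Phi> D l y x2"
  shows "\<Phi> *v x1 = \<Phi> *v x2"
proof -
  obtain p q where p: "certificate \<Phi> D l y x1 p" and q: "certificate \<Phi> D l y x2 q"
    using assms solution_imp_certificate by metis
  let ?h = "x1 - x2"
  have "p \<bullet> (transpose D *v x1) = norm1 (transpose D *v x1)"
    "q \<bullet> (transpose D *v x2) = norm1 (transpose D *v x2)"
    using p q by (simp_all add: certificate_def norm1_eq_inner[symmetric])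
  moreover have "p \<bullet> (transpose D *v x2) \<le> norm1 (transpose D *v x2)"
    "q \<bullet> (transpose D *v x1) \<le> norm1 (transpose D *v x1)"
    using p q by (auto simp: certificate_def inner_le_norm1)
  ultimately have "0 \<le> (p - q) \<bullet> (transpose D *v ?h)"
    by (simp add: inner_diff_left inner_diff_right matrix_vector_mult_diff_distrib)
  also have "\<dots> = (D *v (p - q)) \<bullet> ?h"
    by (metis inner_commute inner_transpose_mult)
  finally have "0 \<le> (l *\<^sub>R (D *v p) - l *\<^sub>R (D *v q)) \<bullet> ?h"
    using l by (simp add: scaleR_diff_right[symmetric] matrix_vector_mult_diff_distrib[symmetric])
  also have "l *\<^sub>R (D *v p) - l *\<^sub>R (D *v q)
      = transpose \<Phi> *v (y - \<Phi> *v x1) - transpose \<Phi> *v (y - \<Phi> *v x2)"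
    using p q by (simp add: certificate_def)
  also have "\<dots> = - (transpose \<Phi> *v (\<Phi> *v ?h))"
    by (simp add: matrix_vector_mult_diff_distrib)
  also have "\<dots> \<bullet> ?h = - ((\<Phi> *v ?h) \<bullet> (\<Phi> *v ?h))"
    by (simp add: inner_transpose_mult)
  finally have "\<Phi> *v ?h = 0"
    by (metis inner_eq_zero_iff inner_ge_zero neg_0_le_iff_le order_antisym)
  then show ?thesis
    by (simp add: matrix_vector_mult_diff_distrib)
qed

lemma mu_eq:
  assumes "l > 0" "solution \<Phi> D l y x"
  shows "mu \<Phi> D l y = \<Phi> *v x"
  unfolding mu_def using assms solution_image_unique by (intro the_equality) blast+

section \<open>Local affinity off the transition set\<close>

lemma Pi_op_mult:
  "Pi_op \<Phi> D J *v v =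
    transpose \<Phi> *v (\<Phi> *v (A_op \<Phi> D J *v (transpose \<Phi> *v v))) - transpose \<Phi> *v v"
  by (simp add: Pi_op_def matrix_vector_mul_assoc[symmetric] matrix_vector_mult_diff_rdistrib
      matrix_vector_mult_diff_distrib)

lemma Omega_op_mult:
  "Omega_op \<Phi> D J *v v =
    transpose \<Phi> *v (\<Phi> *v (A_op \<Phi> D J *v (sub_cols D (- J) *v v))) - sub_cols D (- J) *v v"
  by (simp add: Omega_op_def matrix_vector_mul_assoc[symmetric] matrix_vector_mult_diff_rdistrib)

text \<open>
  Stationarity tested against \<open>cospace D J\<close> gives \<open>x = A_op (\<Phi>\<^sup>* y - l D' q)\<close>, where \<open>D'\<close> keeps
  the columns outside \<open>J\<close>; substituting this back eliminates \<open>x\<close>.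
\<close>

lemma certificate_Pi_op:
  assumes cert: "certificate \<Phi> D l y x q" and J: "J = cosupport D x" and H: "H_cond \<Phi> D J"
  shows "Pi_op \<Phi> D J *v y = l *\<^sub>R (Omega_op \<Phi> D J *v q - sub_cols D J *v q)"
proof -
  let ?u = "transpose \<Phi> *v y - l *\<^sub>R (sub_cols D (- J) *v q)"
  have g: "transpose \<Phi> *v (\<Phi> *v x) = transpose \<Phi> *v y - l *\<^sub>R (D *v q)"
    using cert by (simp add: certificate_def matrix_vector_mult_diff_distrib algebra_simps)
  have D: "D *v q = sub_cols D (- J) *v q + sub_cols D J *v q"
    using sub_cols_mult_disjoint_union[of "- J" J D q] by (simp add: sub_cols_UNIV)
  have "x = A_op \<Phi> D J *v ?u"
  proof (rule A_op_unique[OF H])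
    show "x \<in> cospace D J"
      by (simp add: J mem_cospace cosupport_def)
    fix v assume v: "v \<in> cospace D J"
    have "(\<Phi> *v v) \<bullet> (\<Phi> *v x) = v \<bullet> (transpose \<Phi> *v (\<Phi> *v x))"
      by (metis inner_commute inner_transpose_mult)
    also have "\<dots> = v \<bullet> ?u"
      unfolding g D using cospace_orthogonal_sub_cols[OF v]
      by (simp add: inner_diff_right inner_add_right)
    finally show "(\<Phi> *v v) \<bullet> (\<Phi> *v x) = v \<bullet> ?u" .
  qed
  then have "A_op \<Phi> D J *v (transpose \<Phi> *v y) = x + l *\<^sub>R (A_op \<Phi> D J *v (sub_cols D (- J) *v q))"
    by (simp add: matrix_vector_mult_diff_distrib matrix_vector_mult_scaleR)
  then show ?thesis
    unfolding Pi_op_mult Omega_op_mult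
    by (simp add: matrix_vector_right_distrib matrix_vector_mult_scaleR g D algebra_simps)
qed

lemma certificate_abs_one_off_cosupport:
  assumes "certificate \<Phi> D l y x q" "i \<notin> cosupport D x"
  shows "\<bar>q $ i\<bar> = 1"
proof -
  have "\<bar>q $ i\<bar> * \<bar>(transpose D *v x) $ i\<bar> = \<bar>(transpose D *v x) $ i\<bar>"
    using assms(1) by (metis abs_abs abs_mult certificate_def)
  then show ?thesis
    using assms(2) by (simp add: cosupport_def)
qed

text \<open>
  Projecting the identity of \<open>certificate_Pi_op\<close> on \<open>cospace D (J - K)\<close> removes the unsaturated
  coordinates of \<open>q\<close>. All that is left of \<open>q\<close> are signs, so \<open>(y, l)\<close> satisfies the equation of the
  piece indexed by \<open>J\<close>, \<open>K\<close> and these signs; that piece must be missing from the union.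
\<close>

lemma im_Pi_op_subset:
  assumes l: "l > 0" and y: "y \<notin> H_slice \<Phi> D l"
    and cert: "certificate \<Phi> D l y x q" and J: "J = cosupport D x" and H: "H_cond \<Phi> D J"
    and K: "K = {i \<in> J. \<bar>q $ i\<bar> = 1}"
  shows "im_mat (Pi_op \<Phi> D J) \<subseteq> im_mat (sub_cols D (J - K))"
proof (rule ccontr)
  assume not_sub: "\<not> ?thesis"
  let ?s = "\<chi> i. if i \<in> - J then q $ i else 0" and ?\<sigma> = "\<chi> i. if i \<in> K then q $ i else 0"
  have KJ: "K \<subseteq> J" using K by auto
  have sign: "q $ i \<in> {-1, 1}" if "\<bar>q $ i\<bar> = 1" for i
    using that by (auto simp: abs_if split: if_splits)
  have "Omega_op \<Phi> D J *v ?s = Omega_op \<Phi> D J *v q"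
    unfolding Omega_op_mult sub_cols_mult_restrict ..
  moreover have "sub_cols D J *v q = sub_cols D K *v q + sub_cols D (J - K) *v q"
    using sub_cols_mult_disjoint_union[of K "J - K" D q] KJ by (simp add: Un_absorb1)
  ultimately have residual: "Pi_op \<Phi> D J *v y
      - l *\<^sub>R (Omega_op \<Phi> D J *v ?s - sub_cols D K *v ?\<sigma>) = - l *\<^sub>R (sub_cols D (J - K) *v q)"
    unfolding certificate_Pi_op[OF cert J H] sub_cols_mult_restrict by (simp add: algebra_simps)
  have "Pi_op \<Phi> D J *v y - l *\<^sub>R (Omega_op \<Phi> D J *v ?s - sub_cols D K *v ?\<sigma>)
      \<in> (cospace D (J - K))\<^sup>\<bottom>"
    unfolding residual using cospace_orthogonal_sub_cols[of _ D "J - K"]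
    by (auto simp: orthogonal_comp_def orthogonal_def)
  from orth_proj_eq_scaled[OF subspace_cospace this]
  have "(y, l) \<in> H_piece \<Phi> D J K ?s ?\<sigma>"
    using l by (simp add: H_piece_def)
  moreover have "?s \<in> signs_on (- J)"
    using certificate_abs_one_off_cosupport[OF cert] sign by (simp add: signs_on_def vecs_on_def J)
  moreover have "?\<sigma> \<in> signs_on K"
    using sign by (simp add: signs_on_def vecs_on_def K)
  ultimately have "(y, l) \<in> H_set \<Phi> D"
    using H KJ not_sub unfolding H_set_def by blast
  then show False
    using y by (simp add: H_slice_def)
qed

text \<open>
  The perturbed certificate is \<open>q - \<tau> / l\<close> with \<open>\<tau>\<close> supported on \<open>J - K\<close> and \<open>D \<tau> = \<Pi> (y' - y)\<close>.
  Such a \<open>\<tau>\<close> depends linearly on \<open>y' - y\<close>, so near \<open>y\<close> the strict inequalities \<open>\<bar>q_i\<bar> < 1\<close> on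
  \<open>J - K\<close> and the signs of \<open>D\<^sup>* x\<close> off \<open>J\<close> persist.
\<close>

lemma solution_locally_affine:
  fixes \<Phi> :: "real^'n^'q" and D :: "real^'p^'n"
  assumes l: "l > 0" and y: "y \<notin> H_slice \<Phi> D l" and sol: "solution \<Phi> D l y x"
    and J: "J = cosupport D x" and H: "H_cond \<Phi> D J"
  shows "\<forall>\<^sub>F y' in nhds y. solution \<Phi> D l y' (x + A_op \<Phi> D J *v (transpose \<Phi> *v (y' - y)))"
proof -
  obtain q where cert: "certificate \<Phi> D l y x q"
    using solution_imp_certificate[OF l sol] ..
  define K where "K = {i \<in> J. \<bar>q $ i\<bar> = 1}"
  have sub: "im_mat (Pi_op \<Phi> D J) \<subseteq> im_mat (sub_cols D (J - K))"
    using im_Pi_op_subset[OF l y cert J H K_def] .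
  obtain r where r: "linear r" "\<And>v. v \<in> range ((*v) (sub_cols D (J - K))) \<Longrightarrow> sub_cols D (J - K) *v r v = v"
    using linear_exists_right_inverse_on[OF matrix_vector_mul_linear subspace_UNIV, of "sub_cols D (J - K)"]
    by blast
  define \<tau> where "\<tau> y' = r (Pi_op \<Phi> D J *v (y' - y))" for y'
  have \<tau>: "sub_cols D (J - K) *v \<tau> y' = Pi_op \<Phi> D J *v (y' - y)" for y'
    unfolding \<tau>_def using sub by (intro r(2)) (auto simp: im_mat_def)
  define q' where "q' y' = q - (1 / l) *\<^sub>R (\<chi> i. if i \<in> J - K then \<tau> y' $ i else 0)" for y'
  define x' where "x' y' = x + A_op \<Phi> D J *v (transpose \<Phi> *v (y' - y))" for y'
  have lin: "(f \<longlongrightarrow> f y) (nhds y)" if "continuous_on UNIV f" for f :: "real^'q \<Rightarrow> 'z::topological_space"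
    using that unfolding tendsto_at_iff_tendsto_nhds[symmetric]
    by (simp add: continuous_on_eq_continuous_at isCont_def)
  have stationary: "transpose \<Phi> *v (y' - \<Phi> *v x' y') = l *\<^sub>R (D *v q' y')" for y'
  proof -
    have "transpose \<Phi> *v (y' - \<Phi> *v x' y') = transpose \<Phi> *v (y - \<Phi> *v x) - Pi_op \<Phi> D J *v (y' - y)"
      by (simp add: x'_def Pi_op_mult matrix_vector_right_distrib matrix_vector_mult_diff_distrib)
    also have "\<dots> = l *\<^sub>R (D *v q) - sub_cols D (J - K) *v \<tau> y'"
      using cert by (simp add: certificate_def \<tau>)
    also have "\<dots> = l *\<^sub>R (D *v q' y')"
      using l by (simp add: q'_def matrix_vector_mult_diff_distrib matrix_vector_mult_scaleR
          sub_cols_mult scaleR_diff_right)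
    finally show ?thesis .
  qed
  have cont_q: "((\<lambda>y'. q' y' $ i) \<longlongrightarrow> q $ i) (nhds y)" for i
  proof -
    have "continuous_on UNIV \<tau>"
      unfolding \<tau>_def
      by (intro continuous_on_compose2[OF linear_continuous_on[of r UNIV]]
          continuous_intros matrix_vector_mult_linear_continuous_on
          continuous_on_compose2[OF matrix_vector_mult_linear_continuous_on[of UNIV]])
         (use r(1) in \<open>auto simp: linear_conv_bounded_linear\<close>)
    then have "continuous_on UNIV (\<lambda>y'. q' y' $ i)"
      unfolding q'_def using l by (cases "i \<in> J - K") (auto intro!: continuous_intros)
    moreover have "q' y $ i = q $ i"
      using linear_0[OF r(1)] by (simp add: q'_def \<tau>_def)
    ultimately show ?thesis
      using lin by metis
  qed
  have cont_c: "((\<lambda>y'. (transpose D *v x' y') $ i) \<longlongrightarrow> (transpose D *v x) $ i) (nhds y)" for i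
  proof -
    have "continuous_on UNIV (\<lambda>y'. (transpose D *v x' y') $ i)"
      unfolding x'_def
      by (intro continuous_intros
          continuous_on_compose2[OF matrix_vector_mult_linear_continuous_on[of UNIV]]) auto
    moreover have "(transpose D *v x' y) $ i = (transpose D *v x) $ i"
      by (simp add: x'_def)
    ultimately show ?thesis
      using lin by metis
  qed
  have "\<forall>\<^sub>F y' in nhds y. \<bar>q' y' $ i\<bar> \<le> 1 \<and>
      q' y' $ i * (transpose D *v x' y') $ i = \<bar>(transpose D *v x' y') $ i\<bar>" for i
  proof (cases "i \<in> J")
    case True
    \<comment> \<open>on \<open>J\<close> the candidate keeps \<open>D\<^sup>* x' = 0\<close>, so only the bound on \<open>q'\<close> is at stake\<close>
    have "x \<in> cospace D J"
      by (simp add: J mem_cospace cosupport_def)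
    then have "x' y' \<in> cospace D J" for y'
      unfolding x'_def by (intro subspace_add subspace_cospace A_op_variational(1)[OF H])
    then have c0: "(transpose D *v x' y') $ i = 0" for y'
      using True by (simp add: mem_cospace)
    have "\<bar>q $ i\<bar> \<le> 1"
      using cert by (simp add: certificate_def)
    then consider "i \<in> K" | "i \<in> J - K" "\<bar>q $ i\<bar> < 1"
      using True by (cases "\<bar>q $ i\<bar> = 1") (auto simp: K_def less_le)
    then have "\<forall>\<^sub>F y' in nhds y. \<bar>q' y' $ i\<bar> \<le> 1"
    proof cases
      case 1
      then show ?thesis
        by (simp add: q'_def K_def)
    next
      case 2
      from order_tendstoD(2)[OF tendsto_rabs[OF cont_q] 2(2)] show ?thesis
        by eventually_elim simp
    qed
    then show ?thesis
      by (simp add: c0)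
  next
    case False
    \<comment> \<open>off \<open>J\<close> the dual vector is unchanged, and \<open>D\<^sup>* x'\<close> must keep the sign prescribed by it\<close>
    have q1: "\<bar>q $ i\<bar> = 1"
      using certificate_abs_one_off_cosupport[OF cert] False J by simp
    have "0 < q $ i * (transpose D *v x) $ i"
      using cert False J by (simp add: certificate_def cosupport_def)
    from order_tendstoD(1)[OF tendsto_mult_left[OF cont_c] this] show ?thesis
    proof eventually_elim
      case (elim y')
      then have "q $ i * (transpose D *v x' y') $ i = \<bar>(transpose D *v x' y') $ i\<bar>"
        using q1 by (metis abs_mult abs_of_pos mult_1)
      moreover have "q' y' $ i = q $ i"
        using False by (simp add: q'_def)
      ultimately show ?case
        using q1 by simp
    qed
  qed
  then have "\<forall>\<^sub>F y' in nhds y. \<forall>i. \<bar>q' y' $ i\<bar> \<le> 1 \<and>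
      q' y' $ i * (transpose D *v x' y') $ i = \<bar>(transpose D *v x' y') $ i\<bar>"
    by (rule eventually_all_finite)
  then have "\<forall>\<^sub>F y' in nhds y. solution \<Phi> D l y' (x' y')"
  proof eventually_elim
    case (elim y')
    then have "certificate \<Phi> D l y' (x' y') (q' y')"
      using stationary by (simp add: certificate_def)
    then show ?case
      using l by (intro certificate_imp_solution) auto
  qed
  then show ?thesis
    by (simp add: x'_def)
qed

lemma jacobian_mu:
  fixes \<Phi> :: "real^'n^'q" and D :: "real^'p^'n"
  assumes l: "l > 0" and y: "y \<notin> H_slice \<Phi> D l" and sol: "solution \<Phi> D l y x"
    and J: "J = cosupport D x" and H: "H_cond \<Phi> D J"
  shows "jacobian (mu \<Phi> D l) (at y) = \<Phi> ** A_op \<Phi> D J ** transpose \<Phi>" (is "_ = ?M")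
proof -
  have "\<forall>\<^sub>F y' in nhds y. mu \<Phi> D l y' = \<Phi> *v x + ?M *v (y' - y)"
    using solution_locally_affine[OF assms]
    by eventually_elim
       (simp add: mu_eq[OF l] matrix_vector_right_distrib matrix_vector_mul_assoc matrix_mul_assoc)
  then obtain U where U: "open U" "y \<in> U" "\<And>y'. y' \<in> U \<Longrightarrow> \<Phi> *v x + ?M *v (y' - y) = mu \<Phi> D l y'"
    by (auto simp: eventually_nhds)
  have "((\<lambda>y'. \<Phi> *v x + ?M *v (y' - y)) has_derivative (*v) ?M) (at y)"
    by (auto intro!: derivative_eq_intros bounded_linear.has_derivative[OF matrix_vector_mul_bounded_linear])
  from has_derivative_transform_within_open[OF this U]
  have "(mu \<Phi> D l has_derivative (*v) ?M) (at y)" .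
  then show ?thesis
    by (simp add: jacobian_def frechet_derivative_at[symmetric] matrix_of_matrix_vector_mul)
qed

section \<open>Second moments of the standard normal vector\<close>

text \<open>
  Fubini for products of functions of single coordinates: the Lebesgue measure is the image of a
  product measure, for which the corresponding formula is known.
\<close>

lemma has_bochner_integral_lborel_prod:
  fixes f :: "'a::euclidean_space \<Rightarrow> real \<Rightarrow> real"
  assumes int: "\<And>b. b \<in> Basis \<Longrightarrow> integrable lborel (f b)"
  shows "has_bochner_integral lborel (\<lambda>x. \<Prod>b\<in>Basis. f b (x \<bullet> b))
    (\<Prod>b\<in>Basis. \<integral>t. f b t \<partial>lborel)"
proof -
  interpret product_sigma_finite "\<lambda>_::'a. lborel :: real measure"
    by unfold_locales
  let ?P = "\<Pi>\<^sub>M b\<in>(Basis::'a set). (lborel :: real measure)"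
  let ?T = "\<lambda>g::'a \<Rightarrow> real. \<Sum>b\<in>Basis. g b *\<^sub>R b"
  let ?F = "\<lambda>x::'a. \<Prod>b\<in>Basis. f b (x \<bullet> b)"
  have T: "?T \<in> ?P \<rightarrow>\<^sub>M borel"
    by measurable
  have meas: "f b \<in> borel_measurable borel" if "b \<in> Basis" for b
    using borel_measurable_integrable[OF int[OF that]] by simp
  have F: "?F \<in> borel_measurable borel"
  proof (rule borel_measurable_prod)
    fix b :: 'a assume "b \<in> Basis"
    have "(\<lambda>x::'a. x \<bullet> b) \<in> borel_measurable borel"
      by measurable
    from measurable_compose[OF this meas[OF \<open>b \<in> Basis\<close>]]
    show "(\<lambda>x. f b (x \<bullet> b)) \<in> borel_measurable borel" .
  qed
  have FT: "?F (?T g) = (\<Prod>b\<in>Basis. f b (g b))" for g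
    by (intro prod.cong) auto
  have "integrable ?P (\<lambda>g. \<Prod>b\<in>Basis. f b (g b))"
    by (rule product_integrable_prod) (simp_all add: int)
  moreover have "(\<integral>g. (\<Prod>b\<in>Basis. f b (g b)) \<partial>?P) = (\<Prod>b\<in>Basis. \<integral>t. f b t \<partial>lborel)"
    by (rule product_integral_prod) (simp_all add: int)
  ultimately have "has_bochner_integral (distr ?P borel ?T) ?F (\<Prod>b\<in>Basis. \<integral>t. f b t \<partial>lborel)"
    unfolding has_bochner_integral_iff integrable_distr_eq[OF T F] integral_distr[OF T F] FT
    by simp
  then show ?thesis
    by (simp only: lborel_eq[symmetric])
qed

lemma std_normal_vec_density_prod:
  "std_normal_vec_density (z::real^'q) = (\<Prod>b\<in>Basis. std_normal_density (z \<bullet> b))"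
proof -
  have "(norm z)\<^sup>2 = (\<Sum>b\<in>Basis. (z \<bullet> b)\<^sup>2)"
    unfolding power2_norm_eq_inner by (subst euclidean_inner) (simp add: power2_eq_square)
  moreover have "(\<Prod>b\<in>(Basis :: (real^'q) set). std_normal_density (z \<bullet> b))
      = (1 / sqrt (2 * pi)) ^ CARD('q) * exp (\<Sum>b\<in>Basis. - (z \<bullet> b)\<^sup>2 / 2)"
    by (simp add: std_normal_density_def prod.distrib prod_dividef exp_sum power_divide del: real_sqrt_mult)
  ultimately show ?thesis
    by (simp add: std_normal_vec_density_def sum_negf sum_divide_distrib power_divide del: real_sqrt_mult)
qed

lemma std_normal_vec_second_moment:
  fixes b c :: "real^'q"
  assumes b: "b \<in> Basis" and c: "c \<in> Basis"
  shows "has_bochner_integral lborel (\<lambda>z. std_normal_vec_density z * ((z \<bullet> b) * (z \<bullet> c)))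
    (if b = c then 1 else 0)"
proof -
  \<comment> \<open>the factor of the integrand in coordinate \<open>d\<close>; if \<open>b \<noteq> c\<close>, those at \<open>b\<close> and \<open>c\<close> are odd\<close>
  define f :: "real^'q \<Rightarrow> real \<Rightarrow> real" where "f d t =
    std_normal_density t * ((if d = b then t else 1) * (if d = c then t else 1))" for d t
  have m0: "has_bochner_integral lborel (\<lambda>t. std_normal_density t * 1) 1"
    and m1: "has_bochner_integral lborel (\<lambda>t. std_normal_density t * t) 0"
    and m2: "has_bochner_integral lborel (\<lambda>t. std_normal_density t * (t * t)) 1"
    using std_normal_moment_even[of 0] std_normal_moment_odd[of 0] std_normal_moment_even[of 1]
    by (simp_all add: power2_eq_square)
  have fd: "has_bochner_integral lborel (f d)
      (if d = b \<longleftrightarrow> d = c then 1 else 0)" for d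
    using m0 m1 m2 unfolding f_def by (cases "d = b"; cases "d = c") simp_all
  have "has_bochner_integral lborel (\<lambda>z. \<Prod>d\<in>Basis. f d (z \<bullet> d))
      (\<Prod>d\<in>Basis. \<integral>t. f d t \<partial>lborel)"
    using fd by (intro has_bochner_integral_lborel_prod) (auto simp: has_bochner_integral_iff)
  moreover have "(\<Prod>d\<in>Basis. f d (z \<bullet> d)) = std_normal_vec_density z * ((z \<bullet> b) * (z \<bullet> c))" for z
    using b c by (simp add: f_def prod.distrib std_normal_vec_density_prod)
  moreover have "(\<Prod>d\<in>Basis. \<integral>t. f d t \<partial>lborel) = (if b = c then 1 else 0)"
  proof -
    have "(\<Prod>d\<in>Basis. \<integral>t. f d t \<partial>lborel) = (\<Prod>d\<in>Basis. if d = b \<longleftrightarrow> d = c then 1 else 0)"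
      by (intro prod.cong refl has_bochner_integral_integral_eq fd)
    also have "\<dots> = (if b = c then 1 else 0)"
      using b c by (auto intro: prod_zero)
    finally show ?thesis .
  qed
  ultimately show ?thesis by simp
qed

lemma std_normal_vec_quadratic_form:
  fixes Z :: "'w \<Rightarrow> real^'q" and M :: "real^'q^'q"
  assumes Z: "distributed S lborel Z (\<lambda>z. ennreal (std_normal_vec_density z))"
  shows "has_bochner_integral S (\<lambda>w. Z w \<bullet> (M *v Z w)) (trace M)"
proof -
  have nonneg: "0 \<le> std_normal_vec_density z" for z :: "real^'q"
    by (simp add: std_normal_vec_density_def)
  have mom: "has_bochner_integral S (\<lambda>w. Z w $ i * Z w $ j) (if i = j then 1 else 0)" for i j
  proof -
    have "(axis i 1 :: real^'q) \<in> Basis" "(axis j 1 :: real^'q) \<in> Basis"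
      by (simp_all add: axis_in_Basis_iff)
    from std_normal_vec_second_moment[OF this]
    have L: "has_bochner_integral lborel (\<lambda>z::real^'q. std_normal_vec_density z * (z $ i * z $ j))
        (if i = j then 1 else 0)"
      by (simp add: inner_axis axis_eq_axis)
    have "(\<lambda>z::real^'q. z $ i * z $ j) \<in> borel_measurable lborel"
      by measurable
    from distributed_integrable[OF Z this] distributed_integral[OF Z this] L nonneg
    show ?thesis
      by (simp add: has_bochner_integral_iff)
  qed
  have "has_bochner_integral S (\<lambda>w. \<Sum>i\<in>UNIV. \<Sum>j\<in>UNIV. M $ i $ j * (Z w $ i * Z w $ j))
      (\<Sum>i\<in>UNIV. \<Sum>j\<in>UNIV. M $ i $ j * (if i = j then 1 else 0))"
    by (intro has_bochner_integral_sum has_bochner_integral_mult_right mom)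
  moreover have "(\<Sum>i\<in>UNIV. \<Sum>j\<in>UNIV. M $ i $ j * (Z w $ i * Z w $ j)) = Z w \<bullet> (M *v Z w)" for w
    by (simp add: inner_vec_def matrix_vector_mult_def sum_distrib_left mult_ac)
  moreover have "(\<Sum>i\<in>UNIV. \<Sum>j\<in>UNIV. M $ i $ j * (if i = j then 1 else 0)) = trace M"
    by (simp add: trace_def mult_delta_right)
  ultimately show ?thesis by simp
qed

section \<open>The trace formula\<close>

theorem proposition1:
  fixes \<Phi> :: "real^'n^'q" and D :: "real^'p^'n" and A :: "real^'q^'m"
    and l :: real and y :: "real^'q" and x :: "real^'n" and J :: "'p set"
    and S :: "'w measure" and Z :: "'w \<Rightarrow> real^'q"
  assumes "ker_mat \<Phi> \<inter> ker_mat (transpose D) = {0}"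
    and "l > 0"
    and "y \<notin> H_slice \<Phi> D l"
    and "solution \<Phi> D l y x"
    and "J = cosupport D x"
    and "H_cond \<Phi> D J"
    and "prob_space S"
    and "distributed S lborel Z (\<lambda>z. ennreal (std_normal_vec_density z))"
  shows "(\<forall>z. \<exists>\<nu>. solves_system \<Phi> D J z \<nu>) \<and>
    (\<forall>\<nu>. (\<forall>z. solves_system \<Phi> D J z (\<nu> z)) \<longrightarrow>
      integrable S (\<lambda>w. \<nu> (Z w) \<bullet> ((transpose \<Phi> ** transpose A ** A) *v Z w)) \<and>
      df_hat \<Phi> D A l y =
        prob_space.expectation S (\<lambda>w. \<nu> (Z w) \<bullet> ((transpose \<Phi> ** transpose A ** A) *v Z w)))"
proof (intro conjI allI impI)
  note H = \<open>H_cond \<Phi> D J\<close>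
  show "\<exists>\<nu>. solves_system \<Phi> D J z \<nu>" for z
    by (simp add: solves_system_iff[OF H])
  let ?N = "\<Phi> ** A_op \<Phi> D J ** transpose \<Phi>"
  fix \<nu> assume "\<forall>z. solves_system \<Phi> D J z (\<nu> z)"
  then have \<nu>: "\<nu> z = A_op \<Phi> D J *v (transpose \<Phi> *v z)" for z
    by (simp add: solves_system_iff[OF H])
  have quad: "\<nu> z \<bullet> ((transpose \<Phi> ** transpose A ** A) *v z)
      = z \<bullet> ((transpose A ** (A ** ?N)) *v z)" for z
  proof -
    have "\<nu> z \<bullet> ((transpose \<Phi> ** transpose A ** A) *v z)
        = (transpose \<Phi> *v (transpose A *v (A *v z))) \<bullet> \<nu> z"
      by (simp add: matrix_vector_mul_assoc matrix_mul_assoc inner_commute)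
    also have "\<dots> = (A *v z) \<bullet> (A *v (\<Phi> *v \<nu> z))"
      by (simp only: inner_transpose_mult)
    also have "\<dots> = z \<bullet> (transpose A *v (A *v (\<Phi> *v \<nu> z)))"
      by (metis inner_commute inner_transpose_mult)
    also have "\<dots> = z \<bullet> ((transpose A ** (A ** ?N)) *v z)"
      by (simp add: \<nu> matrix_vector_mul_assoc matrix_mul_assoc)
    finally show ?thesis .
  qed
  have E: "has_bochner_integral S (\<lambda>w. \<nu> (Z w) \<bullet> ((transpose \<Phi> ** transpose A ** A) *v Z w))
      (trace (transpose A ** (A ** ?N)))"
    unfolding quad by (rule std_normal_vec_quadratic_form) fact
  then show "integrable S (\<lambda>w. \<nu> (Z w) \<bullet> ((transpose \<Phi> ** transpose A ** A) *v Z w))"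
    by (simp add: has_bochner_integral_iff)
  have "df_hat \<Phi> D A l y = trace (A ** ?N ** transpose A)"
    using jacobian_mu[OF \<open>l > 0\<close> \<open>y \<notin> H_slice \<Phi> D l\<close> \<open>solution \<Phi> D l y x\<close> \<open>J = cosupport D x\<close> H]
    by (simp add: df_hat_def)
  also have "\<dots> = trace (transpose A ** (A ** ?N))"
    by (rule trace_mul_sym)
  finally show "df_hat \<Phi> D A l y =
      prob_space.expectation S (\<lambda>w. \<nu> (Z w) \<bullet> ((transpose \<Phi> ** transpose A ** A) *v Z w))"
    using E by (simp add: has_bochner_integral_iff)
qed

end
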